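(* Let $G$ be a finite simple graph with vertex set $[n]$, and let $\Delta_G$ be its coloring complex. Then $\Delta_G$ is isomorphic, as a simplicial complex, to the restriction of the simplicial cell decomposition $A_{K_n}\cap S^{n-2}$ to the arrangement $A_G$, i.e. to the subcomplex of $A_{K_n}\cap S^{n-2}$ consisting of those cells contained in the union of the hyperplanes of $A_G$.
   Context: The coloring complex $\Delta_G$ of a graph $G$ on vertex set $V(G)=[n]$ is the simplicial complex whose $(r-1)$-dimensional faces are the ordered lists $T_1|T_2|\cdots|T_r$ of nonempty pairwise disjoint subsets of $V(G)$ such that $\bigcup_{i} T_i \neq V(G)$ and at least one $T_i$ contains both endpoints of some edge of $G$; face inclusion is refinement of such ordered lists (equivalently, $\Delta_G$ is a subcomplex of the order complex of the proper part of the Boolean lattice, a face $T_1|\cdots|T_r$ corresponding to the chain $T_1\subset T_1\cup T_2\subset\cdots\subset T_1\cup\cdots\cup T_r$). For a graph $G$ on $[n]$, $A_G$ is the real hyperplane arrangement in $\mathbb{R}^n$ consisting of the hyperplanes $x_i=x_j$ for each edge $\{i,j\}\in E(G)$; $A_{K_n}$ is the braid arrangement (all hyperplanes $x_i=x_j$, $i<j$). Let $H=\{a\in\mathbb{R}^n:\sum a_i=0\}$ and $S^{n-2}$ the unit sphere of $H$. The hyperplanes of $A_{K_n}$ cut $S^{n-2}$ into a simplicial cell decomposition, denoted $A_{K_n}\cap S^{n-2}$, whose cells correspond to ordered set partitions $S_1|\cdots|S_r$ ($r\ge 2$) of $[n]$: a point $a$ lies in the cell where $S_1$ is the set of coordinates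 attaining the minimum value, $S_2$ the set attaining the minimum among the remaining coordinates, and so on.
   Formalization: In the coloring complex, the edge may also lie in the unlisted nonempty block V(G) minus the union of the T_i; if only the listed T_i count, the claim fails (n=3, single edge 12: one face against two cells). The empty face is left out on both sides. *)

theory Defs
  imports "HOL-Analysis.Analysis"
begin

text \<open>The vertex set \<open>[n]\<close> is the universe of a finite type \<open>'n\<close>, so that \<open>n = CARD('n)\<close>;
  a graph is given by its set of edges.\<close>

definition simple_graph :: "'n::finite set set \<Rightarrow> bool" where
  "simple_graph E \<longleftrightarrow> (\<forall>e\<in>E. card e = 2)"

definition complete_graph :: "'n::finite set set" where
  "complete_graph = {e. card e = 2}"

text \<open>Simplicial complexes consist of nonempty faces only: the empty face is left out everywhere.
  The vertex set of \<open>K\<close> is \<open>\<Union>K\<close>.\<close>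

definition simplicial_complex :: "'a set set \<Rightarrow> bool" where
  "simplicial_complex K \<longleftrightarrow>
     (\<forall>F\<in>K. finite F \<and> F \<noteq> {} \<and> (\<forall>F'. F' \<subseteq> F \<and> F' \<noteq> {} \<longrightarrow> F' \<in> K))"

definition simplicial_isomorphic :: "'a set set \<Rightarrow> 'b set set \<Rightarrow> bool" where
  "simplicial_isomorphic K L \<longleftrightarrow>
     (\<exists>f. bij_betw f (\<Union>K) (\<Union>L) \<and> (`) f ` K = L)"

text \<open>The ordered lists \<open>T\<^sub>1|\<dots>|T\<^sub>r\<close> with \<open>r \<ge> 1\<close>. The edge may also lie in the last, unwritten block
  \<open>- (T\<^sub>1 \<union> \<dots> \<union> T\<^sub>r)\<close>, which is nonempty. Without this block the lists would not be closed under
  passing to subchains: if only \<open>T\<^sub>r\<close> contains an edge, that edge lies in the unwritten block of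
  the face \<open>T\<^sub>1|\<dots>|T\<^bsub>r-1\<^esub>\<close>.\<close>

definition coloring_lists :: "'n::finite set set \<Rightarrow> 'n set list set" where
  "coloring_lists E =
     {Ts. Ts \<noteq> [] \<and> (\<forall>T\<in>set Ts. T \<noteq> {}) \<and> sorted_wrt disjnt Ts \<and> \<Union>(set Ts) \<noteq> UNIV \<and>
          (\<exists>T\<in>set (Ts @ [- \<Union>(set Ts)]). \<exists>e\<in>E. e \<subseteq> T)}"

definition chain_of_list :: "'n set list \<Rightarrow> 'n set set" where
  "chain_of_list Ts = {\<Union>(set (take i Ts)) | i. 1 \<le> i \<and> i \<le> length Ts}"

text \<open>Refinement of ordered lists is inclusion of the corresponding chains.\<close>

definition coloring_complex :: "'n::finite set set \<Rightarrow> 'n set set set" where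
  "coloring_complex E = chain_of_list ` coloring_lists E"

text \<open>In an arrangement the pair \<open>(a, b)\<close> stands for the hyperplane \<open>a \<bullet> x = b\<close>.\<close>

definition graphic_arrangement :: "'n::finite set set \<Rightarrow> ((real^'n) \<times> real) set" where
  "graphic_arrangement E = {(axis i 1 - axis j 1, 0) | i j. {i, j} \<in> E}"

definition arrangement_union :: "('a::real_inner \<times> real) set \<Rightarrow> 'a set" where
  "arrangement_union A = (\<Union>(a, b)\<in>A. {x. a \<bullet> x = b})"

text \<open>The relatively open face of the arrangement containing \<open>x\<close>: all points on the same side of,
  or on, every hyperplane as \<open>x\<close> is.\<close>

definition arrangement_cell :: "('a::real_inner \<times> real) set \<Rightarrow> 'a \<Rightarrow> 'a set" where
  "arrangement_cell A x = {y. \<forall>(a, b)\<in>A. sgn (a \<bullet> y - b) = sgn (a \<bullet> x - b)}"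

definition sum_zero_sphere :: "(real^'n::finite) set" where
  "sum_zero_sphere = {a. (\<Sum>i\<in>UNIV. a $ i) = 0} \<inter> sphere 0 1"

definition braid_cells :: "(real^'n::finite) set set" where
  "braid_cells =
     {arrangement_cell (graphic_arrangement complete_graph) x \<inter> sum_zero_sphere | x.
        x \<in> sum_zero_sphere}"

definition restricted_cells :: "'n::finite set set \<Rightarrow> (real^'n) set set" where
  "restricted_cells E = {C \<in> braid_cells. C \<subseteq> arrangement_union (graphic_arrangement E)}"

definition cell_vertices :: "'a::topological_space set set \<Rightarrow> 'a set \<Rightarrow> 'a set" where
  "cell_vertices \<C> C = {v. {v} \<in> \<C> \<and> v \<in> closure C}"

definition vertex_scheme :: "'a::topological_space set set \<Rightarrow> 'a set set" where
  "vertex_scheme \<C> = cell_vertices \<C> ` \<C>"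

text \<open>A family of open cells is simplicial if it is faithfully encoded by its vertex scheme: cells
  are determined by their vertices and the face relation (a cell lies in the closure of another)
  becomes inclusion of vertex sets.\<close>

definition simplicial_cells :: "'a::topological_space set set \<Rightarrow> bool" where
  "simplicial_cells \<C> \<longleftrightarrow>
     simplicial_complex (vertex_scheme \<C>) \<and> inj_on (cell_vertices \<C>) \<C> \<and>
     (\<forall>C\<in>\<C>. \<forall>D\<in>\<C>. C \<subseteq> closure D \<longleftrightarrow> cell_vertices \<C> C \<subseteq> cell_vertices \<C> D)"

end

theory Submission
  imports Defs
begin

text \<open>A point \<open>x\<close> of the sphere is encoded by the chain of the proper nonempty sublevel sets of its
  coordinate function. Two points lie in the same braid cell iff their chains agree, and moving
  from \<open>y\<close> to \<open>y + t *\<^sub>R x\<close> shows that the closure of a cell consists of the points whose chain is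
  contained in that of the cell. Every chain \<open>c\<close> occurs: counting the members of \<open>c\<close> that miss \<open>i\<close>
  gives a function of \<open>i\<close> with sublevel sets \<open>c\<close>. A point with a one-element chain takes only two
  values, so it is determined up to a positive affine change, hence uniquely on the sphere. Finally
  \<open>x\<close> lies on the hyperplane of an edge iff no sublevel set of \<open>x\<close> splits the edge, and for the
  chain of \<open>T\<^sub>1|\<dots>|T\<^sub>r\<close> this says that the edge lies in one block, the unwritten last one included.\<close>

section \<open>Cells indexed by a simplicial complex\<close>

lemma simplicial_complex_subface:
  "simplicial_complex K \<Longrightarrow> F \<in> K \<Longrightarrow> G \<subseteq> F \<Longrightarrow> G \<noteq> {} \<Longrightarrow> G \<in> K"
  unfolding simplicial_complex_def by blast

lemma simplicial_complex_image:
  assumes "simplicial_complex K"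
  shows "simplicial_complex ((`) f ` K)"
  unfolding simplicial_complex_def
proof (intro ballI conjI allI impI)
  fix F assume "F \<in> (`) f ` K"
  then obtain G where G: "G \<in> K" "F = f ` G" by blast
  then show "finite F" "F \<noteq> {}" using assms by (auto simp: simplicial_complex_def)
  fix F' assume "F' \<subseteq> F \<and> F' \<noteq> {}"
  then obtain G' where "G' \<subseteq> G" "G' \<noteq> {}" "F' = f ` G'"
    unfolding G subset_image_iff by blast
  then show "F' \<in> (`) f ` K"
    using simplicial_complex_subface[OF assms G(1)] by blast
qed

lemma simplicial_isomorphic_image:
  assumes "inj_on f (\<Union>K)"
  shows "simplicial_isomorphic K ((`) f ` K)"
proof -
  have "bij_betw f (\<Union>K) (\<Union>((`) f ` K))"
    using assms by (auto simp: bij_betw_def)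
  then show ?thesis unfolding simplicial_isomorphic_def by blast
qed

locale cellular_realization =
  fixes K :: "'a set set" and cell :: "'a set \<Rightarrow> 'b::t1_space set" and vertex :: "'a \<Rightarrow> 'b"
  assumes simplicial: "simplicial_complex K"
    and cell_singleton: "{v} \<in> K \<Longrightarrow> cell {v} = {vertex v}"
    and cell_subset_closure_iff: "F \<in> K \<Longrightarrow> G \<in> K \<Longrightarrow> cell F \<subseteq> closure (cell G) \<longleftrightarrow> F \<subseteq> G"
begin

lemma singleton_face: "F \<in> K \<Longrightarrow> v \<in> F \<Longrightarrow> {v} \<in> K"
  using simplicial_complex_subface[OF simplicial, of F "{v}"] by simp

lemma vertex_in_closure_iff:
  "{v} \<in> K \<Longrightarrow> F \<in> K \<Longrightarrow> vertex v \<in> closure (cell F) \<longleftrightarrow> v \<in> F"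
  using cell_subset_closure_iff[of "{v}" F] by (simp add: cell_singleton)

lemma inj_on_vertex: "inj_on vertex (\<Union>K)"
proof (rule inj_onI)
  fix u v assume "u \<in> \<Union>K" "v \<in> \<Union>K" and vertex_eq: "vertex u = vertex v"
  then have "{u} \<in> K" "{v} \<in> K" using singleton_face by blast+
  then show "u = v"
    using vertex_in_closure_iff[of u "{v}"] vertex_eq by (simp add: cell_singleton)
qed

lemma cell_eq_singletonD:
  assumes "F \<in> K" "cell F = {w}" "v \<in> F"
  shows "w = vertex v"
  using assms vertex_in_closure_iff[OF singleton_face, of F v F] by simp

lemma cell_vertices_cell:
  assumes F: "F \<in> K"
  shows "cell_vertices (cell ` K) (cell F) = vertex ` F"
proof
  show "cell_vertices (cell ` K) (cell F) \<subseteq> vertex ` F"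
  proof
    fix w assume "w \<in> cell_vertices (cell ` K) (cell F)"
    then obtain G where G: "G \<in> K" "cell G = {w}" and w: "w \<in> closure (cell F)"
      by (auto simp: cell_vertices_def)
    obtain v where "v \<in> G" using G simplicial by (fastforce simp: simplicial_complex_def)
    then have "w = vertex v" "{v} \<in> K"
      using cell_eq_singletonD G singleton_face by blast+
    then show "w \<in> vertex ` F" using w F vertex_in_closure_iff by blast
  qed
  show "vertex ` F \<subseteq> cell_vertices (cell ` K) (cell F)"
  proof
    fix w assume "w \<in> vertex ` F"
    then obtain v where v: "v \<in> F" "w = vertex v" by blast
    then have "{v} \<in> K" using F singleton_face by blast
    then show "w \<in> cell_vertices (cell ` K) (cell F)"
      using v F cell_singleton vertex_in_closure_iff unfolding cell_vertices_def by blast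
  qed
qed

lemma vertex_scheme_cells: "vertex_scheme (cell ` K) = (`) vertex ` K"
  unfolding vertex_scheme_def by (simp add: image_image cell_vertices_cell)

lemma vertex_image_subset_iff:
  "F \<in> K \<Longrightarrow> G \<in> K \<Longrightarrow> vertex ` F \<subseteq> vertex ` G \<longleftrightarrow> F \<subseteq> G"
  using inj_on_image_subset_iff[OF inj_on_vertex] by (simp add: Union_upper)

theorem simplicial_cells: "simplicial_cells (cell ` K)"
  unfolding simplicial_cells_def
proof (intro conjI)
  show "simplicial_complex (vertex_scheme (cell ` K))"
    unfolding vertex_scheme_cells by (rule simplicial_complex_image[OF simplicial])
  show "inj_on (cell_vertices (cell ` K)) (cell ` K)"
  proof (rule inj_onI, elim imageE, hypsubst)
    fix F G
    assume "F \<in> K" "G \<in> K" "cell_vertices (cell ` K) (cell F) = cell_vertices (cell ` K) (cell G)"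
    then show "cell F = cell G"
      using vertex_image_subset_iff[of F G] vertex_image_subset_iff[of G F]
      by (simp add: cell_vertices_cell)
  qed
  show "\<forall>C\<in>cell ` K. \<forall>D\<in>cell ` K. C \<subseteq> closure D \<longleftrightarrow>
      cell_vertices (cell ` K) C \<subseteq> cell_vertices (cell ` K) D"
    by (simp add: cell_vertices_cell cell_subset_closure_iff vertex_image_subset_iff)
qed

theorem simplicial_isomorphic_vertex_scheme: "simplicial_isomorphic K (vertex_scheme (cell ` K))"
  unfolding vertex_scheme_cells by (rule simplicial_isomorphic_image[OF inj_on_vertex])

end

section \<open>Chains of sublevel sets\<close>

definition sublevels :: "('a \<Rightarrow> 'b::linorder) \<Rightarrow> 'a set set" where
  "sublevels f = {S. S \<noteq> {} \<and> S \<noteq> UNIV \<and> (\<forall>i\<in>S. \<forall>j\<in>-S. f i < f j)}"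

definition splits :: "'a set \<Rightarrow> 'a set \<Rightarrow> bool" where
  "splits S e \<longleftrightarrow> \<not> e \<subseteq> S \<and> e \<inter> S \<noteq> {}"

lemma le_iff_sublevels: "f i \<le> f j \<longleftrightarrow> (\<forall>S\<in>sublevels f. j \<in> S \<longrightarrow> i \<in> S)"
proof
  assume "f i \<le> f j"
  then show "\<forall>S\<in>sublevels f. j \<in> S \<longrightarrow> i \<in> S"
    by (auto simp: sublevels_def Ball_def simp flip: not_less)
next
  assume lower: "\<forall>S\<in>sublevels f. j \<in> S \<longrightarrow> i \<in> S"
  show "f i \<le> f j"
  proof (rule ccontr)
    assume "\<not> f i \<le> f j"
    then have "{k. f k \<le> f j} \<in> sublevels f"
      by (auto simp: sublevels_def)
    with lower \<open>\<not> f i \<le> f j\<close> show False by fastforce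
  qed
qed

lemma eq_iff_sublevels: "f i = f j \<longleftrightarrow> (\<forall>S\<in>sublevels f. \<not> splits S {i, j})"
proof -
  have "splits S {i, j} \<longleftrightarrow> (i \<in> S) \<noteq> (j \<in> S)" for S
    by (auto simp: splits_def)
  then show ?thesis
    by (auto simp: order_eq_iff[of "f i"] le_iff_sublevels)
qed

lemma sublevels_subset_iff:
  "sublevels g \<subseteq> sublevels f \<longleftrightarrow> (\<forall>i j. f i \<le> f j \<longrightarrow> g i \<le> g j)"
proof
  assume "sublevels g \<subseteq> sublevels f"
  then show "\<forall>i j. f i \<le> f j \<longrightarrow> g i \<le> g j"
    unfolding le_iff_sublevels by blast
next
  assume "\<forall>i j. f i \<le> f j \<longrightarrow> g i \<le> g j"
  then show "sublevels g \<subseteq> sublevels f"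
    unfolding sublevels_def by (fastforce simp flip: not_le)
qed

lemma sublevels_eq_iff:
  "sublevels g = sublevels f \<longleftrightarrow> (\<forall>i j. f i \<le> f j \<longleftrightarrow> g i \<le> g j)"
  using sublevels_subset_iff[of g f] sublevels_subset_iff[of f g] by blast

lemma sublevels_eq_empty_iff: "sublevels f = {} \<longleftrightarrow> (\<forall>i j. f i = f j)"
proof
  assume "sublevels f = {}"
  then show "\<forall>i j. f i = f j" by (simp add: eq_iff_sublevels)
next
  assume "\<forall>i j. f i = f j"
  then have "\<not> f i < f j" for i j by (metis less_irrefl)
  then show "sublevels f = {}" unfolding sublevels_def by blast
qed

lemma sublevels_add_scaled:
  fixes f g :: "'a \<Rightarrow> 'b::linordered_idom"
  assumes "sublevels g \<subseteq> sublevels f" "t > 0"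
  shows "sublevels (\<lambda>i. g i + t * f i) = sublevels f"
  unfolding sublevels_eq_iff
proof (intro allI)
  fix i j
  have mono: "f i \<le> f j \<Longrightarrow> g i \<le> g j" for i j
    using assms(1) by (simp add: sublevels_subset_iff)
  show "f i \<le> f j \<longleftrightarrow> g i + t * f i \<le> g j + t * f j"
  proof (cases "f i \<le> f j")
    case True
    then show ?thesis using mono[OF True] \<open>t > 0\<close> by (simp add: add_mono)
  next
    case False
    then have "g j \<le> g i" "t * f j < t * f i" using mono[of j i] \<open>t > 0\<close> by auto
    then show ?thesis using False by (simp add: not_le add_le_less_mono)
  qed
qed

lemma subset_chain_sublevels: "subset.chain UNIV (sublevels f)"
proof -
  have "S \<subseteq> T \<or> T \<subseteq> S" if "S \<in> sublevels f" "T \<in> sublevels f" for S T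
  proof (rule ccontr)
    assume "\<not> ?thesis"
    then obtain i j where "i \<in> S" "i \<notin> T" "j \<in> T" "j \<notin> S" by blast
    then have "f i < f j" "f j < f i"
      using that by (auto simp: sublevels_def)
    then show False by simp
  qed
  then show ?thesis by (simp add: subset_chain_def)
qed

definition proper_chains :: "'a set set set" where
  "proper_chains = {c. finite c \<and> c \<noteq> {} \<and> {} \<notin> c \<and> UNIV \<notin> c \<and> subset.chain UNIV c}"

lemma sublevels_in_proper_chains_iff:
  fixes f :: "'a::finite \<Rightarrow> 'b::linorder"
  shows "sublevels f \<in> proper_chains \<longleftrightarrow> sublevels f \<noteq> {}"
  using subset_chain_sublevels[of f] by (auto simp: proper_chains_def sublevels_def)

lemma separated_set_in_chain:
  assumes "finite c" "subset.chain UNIV c" "S \<noteq> {}" "S \<noteq> UNIV"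
    and separated: "\<And>i j. i \<in> S \<Longrightarrow> j \<notin> S \<Longrightarrow> \<exists>T\<in>c. i \<in> T \<and> j \<notin> T"
  shows "S \<in> c"
proof -
  have subchain: "finite d \<and> subset.chain UNIV d" if "d \<subseteq> c" for d
    using assms(1,2) that by (auto simp: subset_chain_def intro: finite_subset)
  have "\<exists>T\<in>c. i \<in> T \<and> T \<subseteq> S" if "i \<in> S" for i
  proof
    have "{T \<in> c. i \<in> T} \<noteq> {}" using separated that \<open>S \<noteq> UNIV\<close> by blast
    then show "\<Inter>{T \<in> c. i \<in> T} \<in> c"
      using Inter_in_chain[of "{T \<in> c. i \<in> T}" UNIV] subchain[of "{T \<in> c. i \<in> T}"] by blast
    show "i \<in> \<Inter>{T \<in> c. i \<in> T} \<and> \<Inter>{T \<in> c. i \<in> T} \<subseteq> S" using separated that by blast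
  qed
  then have union: "\<Union>{T \<in> c. T \<subseteq> S} = S" by blast
  then have "{T \<in> c. T \<subseteq> S} \<noteq> {}" using \<open>S \<noteq> {}\<close> by (metis Union_empty)
  then have "\<Union>{T \<in> c. T \<subseteq> S} \<in> {T \<in> c. T \<subseteq> S}"
    using subchain by (intro Union_in_chain[of _ UNIV]) auto
  then show ?thesis using union by simp
qed

definition chain_rank :: "'a set set \<Rightarrow> 'a \<Rightarrow> nat" where
  "chain_rank c i = card {S \<in> c. i \<notin> S}"

lemma sublevels_chain_rank:
  assumes "c \<in> proper_chains"
  shows "sublevels (chain_rank c) = c"
proof
  have fin: "finite c" and chain: "subset.chain UNIV c"
    using assms by (auto simp: proper_chains_def)
  have less: "chain_rank c i < chain_rank c j" if "S \<in> c" "i \<in> S" "j \<notin> S" for S i j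
  proof -
    have "T \<subseteq> S" if "T \<in> c" "i \<notin> T" for T
      using that \<open>S \<in> c\<close> \<open>i \<in> S\<close> chain unfolding subset_chain_def by blast
    then have "{T \<in> c. i \<notin> T} \<subset> {T \<in> c. j \<notin> T}" using that by blast
    then show ?thesis unfolding chain_rank_def using fin by (simp add: psubset_card_mono)
  qed
  show "c \<subseteq> sublevels (chain_rank c)"
    using assms less unfolding sublevels_def proper_chains_def by blast
  show "sublevels (chain_rank c) \<subseteq> c"
  proof
    fix S assume sublevel: "S \<in> sublevels (chain_rank c)"
    have "\<exists>T\<in>c. i \<in> T \<and> j \<notin> T" if "i \<in> S" "j \<notin> S" for i j
    proof (rule ccontr)
      assume "\<not> ?thesis"
      then have "chain_rank c j \<le> chain_rank c i"
        unfolding chain_rank_def using fin by (intro card_mono) auto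
      moreover have "chain_rank c i < chain_rank c j"
        using sublevel that by (simp add: sublevels_def)
      ultimately show False by simp
    qed
    then show "S \<in> c"
      using sublevel fin chain by (intro separated_set_in_chain) (auto simp: sublevels_def)
  qed
qed

section \<open>Points of the sphere with a prescribed chain\<close>

definition coordinate_mean :: "real^'n::finite \<Rightarrow> real" where
  "coordinate_mean x = (\<Sum>i\<in>UNIV. x $ i) / CARD('n)"

definition standardize :: "real^'n::finite \<Rightarrow> real^'n" where
  "standardize x = sgn (x - vec (coordinate_mean x))"

lemma coordinate_mean_affine: "coordinate_mean (s *\<^sub>R x + vec a) = s * coordinate_mean x + a"
  by (simp add: coordinate_mean_def sum.distrib add_divide_distrib flip: sum_distrib_left)

lemma standardize_ident: "x \<in> sum_zero_sphere \<Longrightarrow> standardize x = x"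
  by (simp add: standardize_def coordinate_mean_def sum_zero_sphere_def sgn_div_norm vec_eq_iff)

lemma standardize_affine:
  assumes "s > 0"
  shows "standardize (s *\<^sub>R x + vec a) = standardize x"
proof -
  have "s *\<^sub>R x + vec a - vec (coordinate_mean (s *\<^sub>R x + vec a)) =
      s *\<^sub>R (x - vec (coordinate_mean x))"
    unfolding coordinate_mean_affine by (simp add: vec_eq_iff algebra_simps)
  then show ?thesis using assms by (simp add: standardize_def sgn_scaleR)
qed

lemma sublevels_standardize: "sublevels (($) (standardize x)) = sublevels (($) x)"
proof -
  have "sublevels (($) (sgn y)) = sublevels (($) y)" for y :: "real^'a"
    by (cases "y = 0") (simp_all add: sublevels_eq_iff sgn_div_norm)
  then show ?thesis by (simp add: standardize_def sublevels_eq_iff)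
qed

lemma sublevels_nonempty_on_sphere:
  assumes "x \<in> sum_zero_sphere"
  shows "sublevels (($) x) \<noteq> {}"
proof
  assume "sublevels (($) x) = {}"
  then have const: "x = vec (x $ i)" for i by (simp add: sublevels_eq_empty_iff vec_eq_iff)
  have "standardize x = 0" by (subst const) (simp add: standardize_def coordinate_mean_def)
  then show False using assms standardize_ident[OF assms] by (simp add: sum_zero_sphere_def)
qed

lemma diff_vec_nonzero:
  fixes x :: "'a::{linorder, group_add}^'n"
  shows "sublevels (($) x) \<noteq> {} \<Longrightarrow> x - vec a \<noteq> 0"
  by (auto simp: sublevels_eq_empty_iff)

lemma standardize_in_sum_zero_sphere:
  assumes "sublevels (($) x) \<noteq> {}"
  shows "standardize x \<in> sum_zero_sphere"
proof -
  define y where "y = x - vec (coordinate_mean x)"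
  have "(\<Sum>i\<in>UNIV. y $ i) = 0" by (simp add: y_def coordinate_mean_def sum_subtractf)
  moreover have "y \<noteq> 0" unfolding y_def by (rule diff_vec_nonzero[OF assms])
  ultimately show ?thesis
    by (simp add: standardize_def sum_zero_sphere_def sgn_div_norm flip: y_def sum_distrib_left)
qed

lemma tendsto_standardize:
  fixes x :: "real^'n::finite"
  assumes "(f \<longlongrightarrow> x) F" "sublevels (($) x) \<noteq> {}"
  shows "((\<lambda>t. standardize (f t)) \<longlongrightarrow> standardize x) F"
proof -
  have "((\<lambda>t. coordinate_mean (f t)) \<longlongrightarrow> coordinate_mean x) F"
    unfolding coordinate_mean_def using assms(1) by (intro tendsto_intros) simp_all
  then have "((\<lambda>t. vec (coordinate_mean (f t)) :: real^'n) \<longlongrightarrow> vec (coordinate_mean x)) F"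
    by (intro vec_tendstoI) simp
  then show ?thesis
    unfolding standardize_def using assms by (intro tendsto_intros diff_vec_nonzero)
qed

definition chain_point :: "'n::finite set set \<Rightarrow> real^'n" where
  "chain_point c = standardize (\<chi> i. real (chain_rank c i))"

lemma sublevels_chain_point:
  assumes "c \<in> proper_chains"
  shows "sublevels (($) (chain_point c)) = c"
proof -
  have "sublevels (($) (chain_point c)) = sublevels (chain_rank c)"
    unfolding chain_point_def sublevels_standardize by (simp add: sublevels_def)
  then show ?thesis using sublevels_chain_rank[OF assms] by simp
qed

lemma chain_point_in_sum_zero_sphere:
  assumes "c \<in> proper_chains"
  shows "chain_point c \<in> sum_zero_sphere"
proof -
  have "sublevels (($) (chain_point c)) \<noteq> {}"
    using assms by (simp add: sublevels_chain_point) (simp add: proper_chains_def)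
  then show ?thesis
    unfolding chain_point_def sublevels_standardize by (rule standardize_in_sum_zero_sphere)
qed

lemma eq_chain_point_singleton:
  assumes "x \<in> sum_zero_sphere" "sublevels (($) x) = {S}"
  shows "x = chain_point {S}"
proof -
  have "S \<in> sublevels (($) x)" using assms by simp
  then obtain k l where blocks: "k \<in> S" "l \<notin> S" and less: "x $ k < x $ l"
    by (auto simp: sublevels_def)
  have same_block: "x $ i = x $ j" if "i \<in> S \<longleftrightarrow> j \<in> S" for i j
    using that assms(2) by (auto simp: eq_iff_sublevels[of "($) x"] splits_def)
  have "x $ i = (if i \<in> S then x $ k else x $ l)" for i
    using blocks by (auto intro: same_block)
  then obtain a b where "a < b" and two_valued: "\<And>i. x $ i = (if i \<in> S then a else b)"
    using less by blast
  have "{T \<in> {S}. i \<notin> T} = (if i \<in> S then {} else {S})" for i by auto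
  then have "chain_rank {S} i = (if i \<in> S then 0 else 1)" for i
    by (simp add: chain_rank_def)
  then have "x = (b - a) *\<^sub>R (\<chi> i. real (chain_rank {S} i)) + vec a"
    by (simp add: vec_eq_iff two_valued)
  then have "standardize x = chain_point {S}"
    using \<open>a < b\<close> by (simp add: standardize_affine chain_point_def)
  then show ?thesis using standardize_ident[OF assms(1)] by simp
qed

section \<open>Cells of the braid arrangement\<close>

definition chain_cell :: "'n::finite set set \<Rightarrow> (real^'n) set" where
  "chain_cell c = {x \<in> sum_zero_sphere. sublevels (($) x) = c}"

lemma chain_point_in_chain_cell: "c \<in> proper_chains \<Longrightarrow> chain_point c \<in> chain_cell c"
  by (simp add: chain_cell_def chain_point_in_sum_zero_sphere sublevels_chain_point)

lemma chain_cell_singleton: "{S} \<in> proper_chains \<Longrightarrow> chain_cell {S} = {chain_point {S}}"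
  using chain_point_in_chain_cell[of "{S}"]
  by (intro equalityI subsetI) (simp_all add: chain_cell_def eq_chain_point_singleton)

lemma standardize_in_chain_cell:
  "sublevels (($) x) = c \<Longrightarrow> c \<noteq> {} \<Longrightarrow> standardize x \<in> chain_cell c"
  by (simp add: chain_cell_def standardize_in_sum_zero_sphere sublevels_standardize)

lemma closed_points_with_subchain:
  "closed {x \<in> sum_zero_sphere. sublevels (($) x) \<subseteq> sublevels f}"
proof -
  have "{x \<in> sum_zero_sphere. sublevels (($) x) \<subseteq> sublevels f} =
      {x. (\<Sum>i\<in>UNIV. x $ i) = 0} \<inter> sphere 0 1 \<inter>
      (\<Inter>i. \<Inter>j\<in>{j. f i \<le> f j}. {x. x $ i \<le> x $ j})"
    unfolding sublevels_subset_iff sum_zero_sphere_def by auto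
  also have "closed \<dots>"
    by (intro closed_Int closed_INT ballI closed_Collect_eq closed_Collect_le closed_sphere
        continuous_intros)
  finally show ?thesis .
qed

lemma closure_chain_cell:
  assumes "c \<in> proper_chains"
  shows "closure (chain_cell c) = {x \<in> sum_zero_sphere. sublevels (($) x) \<subseteq> c}"
proof
  define x where "x = chain_point c"
  have chain_x: "sublevels (($) x) = c" using assms by (simp add: x_def sublevels_chain_point)
  show "closure (chain_cell c) \<subseteq> {x \<in> sum_zero_sphere. sublevels (($) x) \<subseteq> c}"
    using closed_points_with_subchain[of "($) x"] unfolding chain_x
    by (intro closure_minimal) (auto simp: chain_cell_def)
  show "{x \<in> sum_zero_sphere. sublevels (($) x) \<subseteq> c} \<subseteq> closure (chain_cell c)"
  proof safe
    fix y assume on_sphere: "y \<in> sum_zero_sphere" and subchain: "sublevels (($) y) \<subseteq> c"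
    have "standardize (y + t *\<^sub>R x) \<in> chain_cell c" if "t > 0" for t
    proof (rule standardize_in_chain_cell)
      show "sublevels (($) (y + t *\<^sub>R x)) = c"
        using sublevels_add_scaled[of "($) y" "($) x" t] subchain that chain_x
        by (simp add: sublevels_def)
      show "c \<noteq> {}" using assms by (simp add: proper_chains_def)
    qed
    then have "\<forall>\<^sub>F t in at_right 0. standardize (y + t *\<^sub>R x) \<in> closure (chain_cell c)"
      using closure_subset by (auto intro: eventually_mono[OF eventually_at_right_less])
    moreover have "((\<lambda>t. standardize (y + t *\<^sub>R x)) \<longlongrightarrow> standardize y) (at_right 0)"
      using on_sphere
      by (intro tendsto_standardize sublevels_nonempty_on_sphere) (auto intro!: tendsto_eq_intros)
    ultimately have "standardize y \<in> closure (chain_cell c)"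
      by (intro Lim_in_closed_set[OF closed_closure _ trivial_limit_at_right_real])
    then show "y \<in> closure (chain_cell c)" using on_sphere by (simp add: standardize_ident)
  qed
qed

lemma chain_cell_subset_closure_iff:
  assumes "c \<in> proper_chains" "d \<in> proper_chains"
  shows "chain_cell c \<subseteq> closure (chain_cell d) \<longleftrightarrow> c \<subseteq> d"
  using chain_point_in_chain_cell[OF assms(1)] unfolding closure_chain_cell[OF assms(2)]
  by (auto simp: chain_cell_def)

lemma cellular_realization_chain_cell:
  assumes "simplicial_complex K" "K \<subseteq> proper_chains"
  shows "cellular_realization K chain_cell (\<lambda>S. chain_point {S})"
  using assms
  by unfold_locales (auto simp: chain_cell_singleton chain_cell_subset_closure_iff subsetD)

lemma sgn_diff_eq_iff:
  fixes a b c d :: "'a::linordered_idom"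
  shows "sgn (a - b) = sgn (c - d) \<longleftrightarrow> (a \<le> b \<longleftrightarrow> c \<le> d) \<and> (b \<le> a \<longleftrightarrow> d \<le> c)"
  by (auto simp: sgn_if)

lemma arrangement_cell_graphic_arrangement:
  "arrangement_cell (graphic_arrangement E) x =
    {y. \<forall>i j. {i, j} \<in> E \<longrightarrow> sgn (y $ i - y $ j) = sgn (x $ i - x $ j)}"
proof -
  have "arrangement_cell (graphic_arrangement E) x =
      {y. \<forall>i j. {i, j} \<in> E \<longrightarrow> sgn ((axis i 1 - axis j 1) \<bullet> y) = sgn ((axis i 1 - axis j 1) \<bullet> x)}"
    unfolding arrangement_cell_def graphic_arrangement_def by fastforce
  then show ?thesis by (simp add: inner_diff_left inner_axis')
qed

lemma braid_cell_eq_chain_cell: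
  "arrangement_cell (graphic_arrangement complete_graph) x \<inter> sum_zero_sphere =
     chain_cell (sublevels (($) x))"
proof -
  have edge_iff: "{i, j} \<in> complete_graph \<longleftrightarrow> i \<noteq> j" for i j :: 'a
    by (simp add: complete_graph_def card_insert_if)
  have "(\<forall>i j. i \<noteq> j \<longrightarrow> sgn (y $ i - y $ j) = sgn (x $ i - x $ j)) \<longleftrightarrow>
      (\<forall>i j. x $ i \<le> x $ j \<longleftrightarrow> y $ i \<le> y $ j)" for y
    unfolding sgn_diff_eq_iff by (metis order_refl)
  then have "arrangement_cell (graphic_arrangement complete_graph) x =
      {y. sublevels (($) y) = sublevels (($) x)}"
    by (simp add: arrangement_cell_graphic_arrangement edge_iff sublevels_eq_iff)
  then show ?thesis by (auto simp: chain_cell_def)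
qed

lemma sublevels_image_sum_zero_sphere:
  "(\<lambda>x :: real^'n::finite. sublevels (($) x)) ` sum_zero_sphere = proper_chains"
proof
  show "(\<lambda>x :: real^'n. sublevels (($) x)) ` sum_zero_sphere \<subseteq> proper_chains"
    by (simp add: image_subset_iff sublevels_in_proper_chains_iff sublevels_nonempty_on_sphere)
  show "proper_chains \<subseteq> (\<lambda>x :: real^'n. sublevels (($) x)) ` sum_zero_sphere"
  proof
    fix c :: "'n set set" assume "c \<in> proper_chains"
    then show "c \<in> (\<lambda>x. sublevels (($) x)) ` sum_zero_sphere"
      by (intro image_eqI[of _ _ "chain_point c"])
        (simp_all add: sublevels_chain_point chain_point_in_sum_zero_sphere)
  qed
qed

lemma braid_cells_eq: "braid_cells = chain_cell ` proper_chains"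
  unfolding braid_cells_def braid_cell_eq_chain_cell sublevels_image_sum_zero_sphere[symmetric]
  by (simp add: Setcompr_eq_image image_image)

section \<open>Cells on the graphic arrangement\<close>

definition unsplit_chains :: "'a set set \<Rightarrow> 'a set set set" where
  "unsplit_chains E = {c \<in> proper_chains. \<exists>e\<in>E. \<forall>S\<in>c. \<not> splits S e}"

lemma simplicial_complex_unsplit_chains: "simplicial_complex (unsplit_chains E)"
  unfolding simplicial_complex_def
proof (intro ballI conjI allI impI)
  fix c assume unsplit: "c \<in> unsplit_chains E"
  then show "finite c" "c \<noteq> {}" by (auto simp: unsplit_chains_def proper_chains_def)
  fix d assume subchain: "d \<subseteq> c \<and> d \<noteq> {}"
  then have "d \<in> proper_chains"
    using unsplit by (auto simp: unsplit_chains_def proper_chains_def subset_chain_def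
        intro: finite_subset)
  moreover have "\<exists>e\<in>E. \<forall>S\<in>d. \<not> splits S e"
    using unsplit subchain unfolding unsplit_chains_def by blast
  ultimately show "d \<in> unsplit_chains E" by (simp add: unsplit_chains_def)
qed

lemma mem_arrangement_union_graphic_arrangement:
  "x \<in> arrangement_union (graphic_arrangement E) \<longleftrightarrow> (\<exists>i j. {i, j} \<in> E \<and> x $ i = x $ j)"
  by (auto simp: arrangement_union_def graphic_arrangement_def inner_diff_left inner_axis')

lemma restricted_cells_eq:
  assumes "simple_graph E"
  shows "restricted_cells E = chain_cell ` unsplit_chains E"
proof -
  have "x \<in> arrangement_union (graphic_arrangement E) \<longleftrightarrow>
      (\<exists>e\<in>E. \<forall>S\<in>sublevels (($) x). \<not> splits S e)" for x
  proof -
    have "\<exists>i j. e = {i, j}" if "e \<in> E" for e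
      using assms that unfolding simple_graph_def card_2_iff by metis
    then show ?thesis
      unfolding mem_arrangement_union_graphic_arrangement eq_iff_sublevels[of "($) x"] by metis
  qed
  then have "chain_cell c \<subseteq> arrangement_union (graphic_arrangement E) \<longleftrightarrow> c \<in> unsplit_chains E"
    if "c \<in> proper_chains" for c
    using that chain_point_in_chain_cell[OF that] by (auto simp: unsplit_chains_def chain_cell_def)
  moreover have "unsplit_chains E \<subseteq> proper_chains" by (auto simp: unsplit_chains_def)
  ultimately show ?thesis unfolding restricted_cells_def braid_cells_eq by blast
qed

section \<open>Faces of the coloring complex\<close>

lemma chain_of_list_Nil: "chain_of_list [] = {}"
  by (auto simp: chain_of_list_def)

lemma chain_of_list_snoc:
  "chain_of_list (Ts @ [T]) = insert (\<Union>(set Ts) \<union> T) (chain_of_list Ts)"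
proof -
  have "{i. 1 \<le> i \<and> i \<le> length (Ts @ [T])} = insert (Suc (length Ts)) {i. 1 \<le> i \<and> i \<le> length Ts}"
    by auto
  moreover have "chain_of_list Us = (\<lambda>i. \<Union>(set (take i Us))) ` {i. 1 \<le> i \<and> i \<le> length Us}"
    for Us :: "'a set list"
    by (auto simp: chain_of_list_def)
  ultimately show ?thesis by (auto simp: Un_commute)
qed

lemma Union_chain_of_list: "\<Union>(chain_of_list Ts) = \<Union>(set Ts)"
  by (induction Ts rule: rev_induct) (auto simp: chain_of_list_Nil chain_of_list_snoc)

lemma subset_chain_chain_of_list: "subset.chain UNIV (chain_of_list Ts)"
proof (induction Ts rule: rev_induct)
  case Nil
  then show ?case by (simp add: chain_of_list_Nil subset_chain_def)
next
  case (snoc T Ts)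
  then show ?case
    using Union_chain_of_list[of Ts] by (auto simp: chain_of_list_snoc subset_chain_insert)
qed

lemma chain_of_list_in_proper_chains_iff:
  assumes "\<forall>T\<in>set Ts. T \<noteq> {}"
  shows "chain_of_list Ts \<in> proper_chains \<longleftrightarrow> Ts \<noteq> [] \<and> \<Union>(set Ts) \<noteq> UNIV"
proof (cases Ts rule: rev_cases)
  case Nil
  then show ?thesis by (simp add: chain_of_list_Nil proper_chains_def)
next
  case (snoc Us U)
  have "{} \<notin> chain_of_list Ts" "finite (chain_of_list Ts)"
    using assms
    by (induction Ts rule: rev_induct) (auto simp: chain_of_list_Nil chain_of_list_snoc)
  moreover have top: "\<Union>(set Ts) \<in> chain_of_list Ts"
    using snoc by (simp add: chain_of_list_snoc Un_commute)
  then have "UNIV \<in> chain_of_list Ts \<longleftrightarrow> \<Union>(set Ts) = UNIV"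
    unfolding Union_chain_of_list[symmetric] by (metis Union_upper top.extremum_uniqueI)
  ultimately show ?thesis
    using snoc top subset_chain_chain_of_list[of Ts]
    by (auto simp: proper_chains_def)
qed

lemma chain_of_list_unsplit_iff:
  assumes "sorted_wrt disjnt Ts" "e \<noteq> {}"
  shows "(\<forall>S\<in>chain_of_list Ts. \<not> splits S e) \<longleftrightarrow> (\<exists>T\<in>set (Ts @ [- \<Union>(set Ts)]). e \<subseteq> T)"
  using assms(1)
proof (induction Ts rule: rev_induct)
  case Nil
  then show ?case by (simp add: chain_of_list_Nil)
next
  case (snoc T Ts)
  have "sorted_wrt disjnt Ts" and disj: "\<Union>(set Ts) \<inter> T = {}"
    using snoc.prems by (simp_all add: sorted_wrt_append) (auto simp: disjnt_def)
  then have unsplit_iff: "(\<forall>S\<in>chain_of_list Ts. \<not> splits S e) \<longleftrightarrow>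
      (\<exists>T\<in>set Ts. e \<subseteq> T) \<or> e \<subseteq> - \<Union>(set Ts)"
    using snoc.IH by auto
  have "\<not> splits (\<Union>(set Ts) \<union> T) e" if "\<exists>T\<in>set Ts. e \<subseteq> T"
    using that unfolding splits_def by blast
  moreover have "\<not> splits (\<Union>(set Ts) \<union> T) e \<and> e \<subseteq> - \<Union>(set Ts) \<longleftrightarrow>
      e \<subseteq> T \<or> e \<subseteq> - (\<Union>(set Ts) \<union> T)"
    using disj assms(2) unfolding splits_def by blast
  ultimately have "(\<forall>S\<in>chain_of_list (Ts @ [T]). \<not> splits S e) \<longleftrightarrow>
      (\<exists>T\<in>set Ts. e \<subseteq> T) \<or> e \<subseteq> T \<or> e \<subseteq> - (\<Union>(set Ts) \<union> T)"
    unfolding chain_of_list_snoc ball_simps unsplit_iff by blast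
  then show ?case by (auto simp: Un_commute)
qed

lemma finite_subset_chain_induct [consumes 2, case_names empty insert]:
  assumes "finite c" "subset.chain UNIV c"
    and "P {}"
    and insert: "\<And>S c. finite c \<Longrightarrow> subset.chain UNIV c \<Longrightarrow> \<forall>T\<in>c. T \<subset> S \<Longrightarrow> P c \<Longrightarrow> P (insert S c)"
  shows "P c"
  using assms(1,2)
proof (induction c rule: finite_psubset_induct)
  case (psubset c)
  show ?case
  proof (cases "c = {}")
    case False
    define d where "d = c - {\<Union>c}"
    have "\<Union>c \<in> c" using Union_in_chain[OF psubset.hyps False psubset.prems] .
    then have "c = insert (\<Union>c) d" "d \<subset> c" by (auto simp: d_def)
    moreover have "finite d" "subset.chain UNIV d" "\<forall>T\<in>d. T \<subset> \<Union>c"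
      using psubset.hyps psubset.prems by (auto simp: d_def subset_chain_def)
    ultimately show ?thesis using insert[of d "\<Union>c"] psubset.IH by metis
  qed (use \<open>P {}\<close> in simp)
qed

lemma ex_list_with_chain:
  assumes "finite c" "subset.chain UNIV c" "{} \<notin> c"
  shows "\<exists>Ts. (\<forall>T\<in>set Ts. T \<noteq> {}) \<and> sorted_wrt disjnt Ts \<and> chain_of_list Ts = c"
  using assms
proof (induction c rule: finite_subset_chain_induct)
  case empty
  then show ?case by (intro exI[of _ "[]"]) (simp add: chain_of_list_Nil)
next
  case (insert S c)
  then obtain Ts where Ts: "\<forall>T\<in>set Ts. T \<noteq> {}" "sorted_wrt disjnt Ts" "chain_of_list Ts = c"
    by auto
  have union: "\<Union>(set Ts) = \<Union>c" using Ts(3) Union_chain_of_list by metis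
  have "\<Union>c \<subset> S"
  proof (cases "c = {}")
    case True
    then show ?thesis using insert.prems by auto
  next
    case False
    then show ?thesis using Union_in_chain insert.hyps by blast
  qed
  then have "\<forall>T\<in>set (Ts @ [S - \<Union>c]). T \<noteq> {}" "sorted_wrt disjnt (Ts @ [S - \<Union>c])"
    "chain_of_list (Ts @ [S - \<Union>c]) = insert S c"
    using Ts union by (auto simp: sorted_wrt_append disjnt_def chain_of_list_snoc)
  then show ?case by blast
qed

lemma mem_coloring_lists_iff:
  assumes "{} \<notin> E" and Ts: "\<forall>T\<in>set Ts. T \<noteq> {}" "sorted_wrt disjnt Ts"
  shows "Ts \<in> coloring_lists E \<longleftrightarrow> chain_of_list Ts \<in> unsplit_chains E"
proof -
  have "(\<exists>T\<in>set (Ts @ [- \<Union>(set Ts)]). \<exists>e\<in>E. e \<subseteq> T) \<longleftrightarrow>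
      (\<exists>e\<in>E. \<exists>T\<in>set (Ts @ [- \<Union>(set Ts)]). e \<subseteq> T)"
    by blast
  also have "\<dots> \<longleftrightarrow> (\<exists>e\<in>E. \<forall>S\<in>chain_of_list Ts. \<not> splits S e)"
    using assms(1) by (intro bex_cong refl chain_of_list_unsplit_iff[OF Ts(2), symmetric]) auto
  finally show ?thesis
    using Ts chain_of_list_in_proper_chains_iff[OF Ts(1)]
    by (simp add: coloring_lists_def unsplit_chains_def)
qed

lemma coloring_complex_eq:
  assumes "{} \<notin> E"
  shows "coloring_complex E = unsplit_chains E"
proof
  show "coloring_complex E \<subseteq> unsplit_chains E"
    unfolding coloring_complex_def
  proof (rule image_subsetI)
    fix Ts assume "Ts \<in> coloring_lists E"
    then show "chain_of_list Ts \<in> unsplit_chains E"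
      using mem_coloring_lists_iff[OF assms, of Ts] by (simp add: coloring_lists_def)
  qed
  show "unsplit_chains E \<subseteq> coloring_complex E"
  proof
    fix c assume unsplit: "c \<in> unsplit_chains E"
    then have "finite c" "subset.chain UNIV c" "{} \<notin> c"
      by (auto simp: unsplit_chains_def proper_chains_def)
    from ex_list_with_chain[OF this] show "c \<in> coloring_complex E"
      using mem_coloring_lists_iff[OF assms] unsplit by (auto simp: coloring_complex_def)
  qed
qed

theorem theorem2p1:
  fixes E :: "'n::finite set set"
  assumes "simple_graph E"
  shows "simplicial_cells (restricted_cells E) \<and>
         simplicial_isomorphic (coloring_complex E) (vertex_scheme (restricted_cells E))"
proof -
  have "{} \<notin> E" using assms by (auto simp: simple_graph_def)
  then have faces: "coloring_complex E = unsplit_chains E" by (rule coloring_complex_eq)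
  have cells: "restricted_cells E = chain_cell ` unsplit_chains E"
    by (rule restricted_cells_eq[OF assms])
  interpret cellular_realization "unsplit_chains E" chain_cell "\<lambda>S. chain_point {S}"
    by (rule cellular_realization_chain_cell[OF simplicial_complex_unsplit_chains])
      (auto simp: unsplit_chains_def)
  show ?thesis
    unfolding faces cells using simplicial_cells simplicial_isomorphic_vertex_scheme ..
qed

end
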